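(* The ring $C^{\omega}[0,1]$ is a principal ideal domain.
   Context: $C^{\omega}[0,1]$ is the ring (pointwise operations) of real analytic functions $f:[0,1]\to\mathbb{R}$, i.e. functions such that for each $a \in [0,1]$ there is a real power series centered at $a$ that converges to $f(x)$ for all $x$ in some relatively open neighborhood of $a$ in $[0,1]$ (one-sided at the endpoints). *)

theory Defs
  imports "HOL-Analysis.Analysis" "HOL-Algebra.Ring_Divisibility"
begin

definition real_analytic_on_unit :: "(real \<Rightarrow> real) \<Rightarrow> bool" where
  "real_analytic_on_unit f \<longleftrightarrow>
    (\<forall>a\<in>{0..1}. \<exists>(c :: nat \<Rightarrow> real) U.
       openin (top_of_set {0..1}) U \<and> a \<in> U \<and>
       (\<forall>x\<in>U. (\<lambda>n. c n * (x - a) ^ n) sums f x))"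

(* A function [0,1] -> R is encoded as a function on real that is undefined off [0,1], so that
   equality in the carrier is equality of functions on [0,1]. *)
definition Comega_ring :: "(real \<Rightarrow> real) ring" where
  "Comega_ring =
    \<lparr> carrier = {f \<in> extensional {0..1}. real_analytic_on_unit f},
      mult = (\<lambda>f g. \<lambda>x\<in>{0..1}. f x * g x),
      one = (\<lambda>x\<in>{0..1}. 1),
      zero = (\<lambda>x\<in>{0..1}. 0),
      add = (\<lambda>f g. \<lambda>x\<in>{0..1}. f x + g x) \<rparr>"

end

theory Submission
  imports Defs
begin

text \<open>
  By the identity theorem, a nonzero analytic function on \<open>[0,1]\<close> has finitely many zeros, each of
  finite order, so it is the product of a polynomial and a nowhere vanishing analytic function, that
  is, a unit. Division with remainder of polynomials then makes the ring Euclidean, the size of a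
  function being the least degree of a polynomial associated to it.
\<close>

section \<open>Local description of analyticity by formal power series\<close>

text \<open>Moving the germ to 0 and comparing it with a function defined on a full neighbourhood
  makes the calculus of \<open>has_fps_expansion\<close> available. The premise
  \<open>a + y \<in> {0..1}\<close> is what makes the condition one-sided at the endpoints.\<close>

definition analytic_in_unit_at :: "(real \<Rightarrow> real) \<Rightarrow> real \<Rightarrow> bool" where
  "analytic_in_unit_at f a \<longleftrightarrow>
    (\<exists>g F. g has_fps_expansion F \<and> (\<forall>\<^sub>F y in nhds 0. a + y \<in> {0..1} \<longrightarrow> f (a + y) = g y))"

text \<open>Expansions live at 0 while zeros and neighbourhoods are discussed at \<open>a\<close>;
  this passes between the two.\<close>

lemma eventually_nhds_shift_iff:
  fixes a :: real
  shows "(\<forall>\<^sub>F y in nhds 0. P (a + y)) \<longleftrightarrow> (\<forall>\<^sub>F x in nhds a. P x)"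
  using filtermap_nhds_shift[of "- a" 0]
  by (simp add: filter_eq_iff eventually_filtermap add.commute)

text \<open>Convergence at one point \<open>z \<noteq> 0\<close> bounds the radius of convergence
  below by the absolute value of \<open>z\<close>, so the radius is positive.\<close>

lemma real_sums_imp_has_fps_expansion:
  fixes c :: "nat \<Rightarrow> real"
  assumes "z \<noteq> 0" "summable (\<lambda>n. c n * z ^ n)"
  shows "eval_fps (Abs_fps c) has_fps_expansion Abs_fps c"
proof (rule eval_fps_has_fps_expansion)
  have "ereal (norm z) \<le> fps_conv_radius (Abs_fps c)"
    using conv_radius_geI[OF assms(2)] by (simp add: fps_conv_radius_def)
  then show "fps_conv_radius (Abs_fps c) > 0"
    using assms(1) by (metis ereal_less(2) less_le_trans zero_less_norm_iff)
qed

lemma real_analytic_on_unit_iff: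
  "real_analytic_on_unit f \<longleftrightarrow> (\<forall>a\<in>{0..1}. analytic_in_unit_at f a)"
proof (intro iffI ballI)
  fix a :: real
  assume f: "real_analytic_on_unit f" and a: "a \<in> {0..1}"
  then obtain c U where U: "openin (top_of_set {0..1}) U" "a \<in> U"
    and sums: "\<And>x. x \<in> U \<Longrightarrow> (\<lambda>n. c n * (x - a) ^ n) sums f x"
    unfolding real_analytic_on_unit_def by meson
  obtain O' where O': "open O'" "U = {0..1} \<inter> O'"
    using U(1) by (auto simp: openin_open)
  \<comment> \<open>A positive radius needs convergence at some point other than the centre. Such a
    point exists in \<open>U\<close> because \<open>[0,1]\<close> has no isolated points.\<close>
  obtain x where x: "x \<in> U" "x \<noteq> a"
    using islimptE[of a "{0..1}" O'] islimpt_Icc[of 0 1 a] a O' U(2) by (metis Int_iff zero_less_one)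
  have "eval_fps (Abs_fps c) has_fps_expansion Abs_fps c"
    using x sums[of x] by (intro real_sums_imp_has_fps_expansion[of "x - a"]) (auto simp: sums_iff)
  moreover have "\<forall>\<^sub>F x in nhds a. x \<in> {0..1} \<longrightarrow> f x = eval_fps (Abs_fps c) (x - a)"
  proof -
    have "\<forall>\<^sub>F x in nhds a. x \<in> O'"
      using O' U(2) by (auto intro: eventually_nhds_in_open)
    then show ?thesis
      by eventually_elim (use sums O'(2) in \<open>auto simp: eval_fps_def sums_iff\<close>)
  qed
  ultimately show "analytic_in_unit_at f a"
    unfolding analytic_in_unit_at_def
    by (subst (asm) eventually_nhds_shift_iff[symmetric]) auto
next
  assume f: "\<forall>a\<in>{0..1}. analytic_in_unit_at f a"
  show "real_analytic_on_unit f"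
    unfolding real_analytic_on_unit_def
  proof
    fix a :: real
    assume a: "a \<in> {0..1}"
    then obtain g F where g: "g has_fps_expansion F"
      and fg: "\<forall>\<^sub>F y in nhds 0. a + y \<in> {0..1} \<longrightarrow> f (a + y) = g y"
      using f unfolding analytic_in_unit_at_def by blast
    \<comment> \<open>\<open>eval_fps F\<close> is known to be the sum of the series only inside the
      disc of convergence, so \<open>y\<close> is kept there.\<close>
    have "\<forall>\<^sub>F y in nhds 0. y \<in> eball 0 (fps_conv_radius F)"
      using g by (intro eventually_nhds_in_open) (auto simp: has_fps_expansion_def zero_ereal_def)
    moreover have "\<forall>\<^sub>F y in nhds 0. eval_fps F y = g y"
      using g by (simp add: has_fps_expansion_def)
    \<comment> \<open>The displacement is left as \<open>(a + y) - a\<close> so that the statement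
      has the shape \<open>P (a + y)\<close> required for the shift to \<open>a\<close>.\<close>
    ultimately have "\<forall>\<^sub>F y in nhds 0. a + y \<in> {0..1} \<longrightarrow>
        (\<lambda>n. fps_nth F n * ((a + y) - a) ^ n) sums f (a + y)"
      using fg
    proof eventually_elim
      case (elim y)
      then show ?case using sums_eval_fps[of y F] by auto
    qed
    then have "\<forall>\<^sub>F x in nhds a. x \<in> {0..1} \<longrightarrow> (\<lambda>n. fps_nth F n * (x - a) ^ n) sums f x"
      by (subst (asm) eventually_nhds_shift_iff)
    then obtain O' where "open O'" "a \<in> O'"
      "\<forall>x\<in>O'. x \<in> {0..1} \<longrightarrow> (\<lambda>n. fps_nth F n * (x - a) ^ n) sums f x"
      unfolding eventually_nhds by blast
    then show "\<exists>c U. openin (top_of_set {0..1}) U \<and> a \<in> U \<and>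
        (\<forall>x\<in>U. (\<lambda>n. c n * (x - a) ^ n) sums f x)"
      using a by (intro exI[of _ "fps_nth F"] exI[of _ "{0..1} \<inter> O'"]) auto
  qed
qed

section \<open>Closure properties of analytic functions\<close>

lemma analytic_in_unit_at_cong:
  assumes "analytic_in_unit_at f a" "\<forall>\<^sub>F x in nhds a. x \<in> {0..1} \<longrightarrow> f x = g x"
  shows "analytic_in_unit_at g a"
proof -
  obtain h F where h: "h has_fps_expansion F"
    and fh: "\<forall>\<^sub>F y in nhds 0. a + y \<in> {0..1} \<longrightarrow> f (a + y) = h y"
    using assms(1) unfolding analytic_in_unit_at_def by blast
  have "\<forall>\<^sub>F y in nhds 0. a + y \<in> {0..1} \<longrightarrow> f (a + y) = g (a + y)"
    using assms(2) by (subst (asm) eventually_nhds_shift_iff[symmetric])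
  with fh have "\<forall>\<^sub>F y in nhds 0. a + y \<in> {0..1} \<longrightarrow> g (a + y) = h y"
    by eventually_elim auto
  with h show ?thesis unfolding analytic_in_unit_at_def by blast
qed

lemma real_analytic_on_unit_cong:
  assumes "real_analytic_on_unit f" "\<And>x. x \<in> {0..1} \<Longrightarrow> f x = g x"
  shows "real_analytic_on_unit g"
  using assms unfolding real_analytic_on_unit_iff
  by (auto intro!: analytic_in_unit_at_cong[where f = f and g = g])

lemma analytic_in_unit_at_const: "analytic_in_unit_at (\<lambda>x. c) a"
  unfolding analytic_in_unit_at_def
  by (intro exI[of _ "\<lambda>x. c"] exI[of _ "fps_const c"]) auto

lemma analytic_in_unit_at_ident: "analytic_in_unit_at (\<lambda>x. x) a"
  unfolding analytic_in_unit_at_def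
  by (intro exI[of _ "\<lambda>y. a + y"] exI[of _ "fps_const a + fps_X"])
     (auto intro!: fps_expansion_intros)

lemma analytic_in_unit_at_add:
  assumes "analytic_in_unit_at f a" "analytic_in_unit_at g a"
  shows "analytic_in_unit_at (\<lambda>x. f x + g x) a"
proof -
  obtain f' F g' G where "f' has_fps_expansion F" "g' has_fps_expansion G"
    and ev: "\<forall>\<^sub>F y in nhds 0. a + y \<in> {0..1} \<longrightarrow> f (a + y) = f' y"
      "\<forall>\<^sub>F y in nhds 0. a + y \<in> {0..1} \<longrightarrow> g (a + y) = g' y"
    using assms unfolding analytic_in_unit_at_def by blast
  then have "(\<lambda>y. f' y + g' y) has_fps_expansion F + G"
    by (intro has_fps_expansion_add)
  moreover have "\<forall>\<^sub>F y in nhds 0. a + y \<in> {0..1} \<longrightarrow> f (a + y) + g (a + y) = f' y + g' y"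
    using ev by eventually_elim auto
  ultimately show ?thesis unfolding analytic_in_unit_at_def by blast
qed

lemma analytic_in_unit_at_mult:
  assumes "analytic_in_unit_at f a" "analytic_in_unit_at g a"
  shows "analytic_in_unit_at (\<lambda>x. f x * g x) a"
proof -
  obtain f' F g' G where "f' has_fps_expansion F" "g' has_fps_expansion G"
    and ev: "\<forall>\<^sub>F y in nhds 0. a + y \<in> {0..1} \<longrightarrow> f (a + y) = f' y"
      "\<forall>\<^sub>F y in nhds 0. a + y \<in> {0..1} \<longrightarrow> g (a + y) = g' y"
    using assms unfolding analytic_in_unit_at_def by blast
  then have "(\<lambda>y. f' y * g' y) has_fps_expansion F * G"
    by (intro has_fps_expansion_mult)
  moreover have "\<forall>\<^sub>F y in nhds 0. a + y \<in> {0..1} \<longrightarrow> f (a + y) * g (a + y) = f' y * g' y"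
    using ev by eventually_elim auto
  ultimately show ?thesis unfolding analytic_in_unit_at_def by blast
qed

lemma has_fps_expansion_at_0:
  assumes "f has_fps_expansion F"
  shows "f 0 = fps_nth F 0"
  using assms by (auto simp: has_fps_expansion_def eval_fps_at_0 dest: eventually_nhds_x_imp_x)

lemma analytic_in_unit_at_inverse:
  assumes "analytic_in_unit_at f a" "a \<in> {0..1}" "f a \<noteq> 0"
  shows "analytic_in_unit_at (\<lambda>x. inverse (f x)) a"
proof -
  obtain g F where g: "g has_fps_expansion F"
    and ev: "\<forall>\<^sub>F y in nhds 0. a + y \<in> {0..1} \<longrightarrow> f (a + y) = g y"
    using assms unfolding analytic_in_unit_at_def by blast
  \<comment> \<open>The constant coefficient is \<open>f a\<close>; a formal power series over a
    field is invertible exactly when this coefficient is nonzero.\<close>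
  have "fps_nth F 0 \<noteq> 0"
    using eventually_nhds_x_imp_x[OF ev] assms has_fps_expansion_at_0[OF g] by simp
  then have "(\<lambda>y. inverse (g y)) has_fps_expansion inverse F"
    using g by (intro has_fps_expansion_inverse)
  moreover have "\<forall>\<^sub>F y in nhds 0. a + y \<in> {0..1} \<longrightarrow> inverse (f (a + y)) = inverse (g y)"
    using ev by eventually_elim auto
  ultimately show ?thesis unfolding analytic_in_unit_at_def by blast
qed

lemma analytic_in_unit_at_poly: "analytic_in_unit_at (poly p) a"
proof (induction p)
  case 0
  then show ?case using analytic_in_unit_at_const[of 0 a] by (simp add: poly_0[abs_def])
next
  case (pCons c p)
  have "poly (pCons c p) = (\<lambda>x. c + x * poly p x)" by auto
  then show ?case
    using analytic_in_unit_at_add[OF analytic_in_unit_at_const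
        analytic_in_unit_at_mult[OF analytic_in_unit_at_ident pCons.IH]] by simp
qed

lemma real_analytic_on_unit_const: "real_analytic_on_unit (\<lambda>x. c)"
  and real_analytic_on_unit_poly: "real_analytic_on_unit (poly p)"
  by (auto simp: real_analytic_on_unit_iff analytic_in_unit_at_const analytic_in_unit_at_poly)

lemma real_analytic_on_unit_add:
  "real_analytic_on_unit f \<Longrightarrow> real_analytic_on_unit g \<Longrightarrow> real_analytic_on_unit (\<lambda>x. f x + g x)"
  and real_analytic_on_unit_mult:
  "real_analytic_on_unit f \<Longrightarrow> real_analytic_on_unit g \<Longrightarrow> real_analytic_on_unit (\<lambda>x. f x * g x)"
  and real_analytic_on_unit_inverse:
  "real_analytic_on_unit f \<Longrightarrow> (\<And>x. x \<in> {0..1} \<Longrightarrow> f x \<noteq> 0) \<Longrightarrow>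
    real_analytic_on_unit (\<lambda>x. inverse (f x))"
  by (auto simp: real_analytic_on_unit_iff analytic_in_unit_at_add analytic_in_unit_at_mult
      analytic_in_unit_at_inverse)

section \<open>Zeros and the identity theorem\<close>

text \<open>The dichotomy is whether the expansion \<open>F\<close> is zero. If it is not, its
  subdegree is the order \<open>k\<close> of vanishing, and the series shifted down by
  \<open>k\<close> has nonzero constant term.\<close>

lemma analytic_in_unit_at_local_form:
  assumes "analytic_in_unit_at f a"
  obtains (zero) "\<forall>\<^sub>F x in nhds a. x \<in> {0..1} \<longrightarrow> f x = 0"
  | (order) k g G where "g has_fps_expansion G" "g 0 \<noteq> 0"
      "\<forall>\<^sub>F x in nhds a. x \<in> {0..1} \<longrightarrow> f x = (x - a) ^ k * g (x - a)"
proof -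
  obtain g F where g: "g has_fps_expansion F"
    and ev: "\<forall>\<^sub>F y in nhds 0. a + y \<in> {0..1} \<longrightarrow> f (a + y) = g y"
    using assms unfolding analytic_in_unit_at_def by blast
  have gF: "\<forall>\<^sub>F y in nhds 0. eval_fps F y = g y"
    using g by (simp add: has_fps_expansion_def)
  show thesis
  proof (cases "F = 0")
    case True
    have "\<forall>\<^sub>F y in nhds 0. a + y \<in> {0..1} \<longrightarrow> f (a + y) = 0"
      using ev gF by eventually_elim (use True in auto)
    then show thesis
      using zero by (subst (asm) eventually_nhds_shift_iff)
  next
    case False
    define k where "k = subdegree F"
    define G where "G = fps_shift k F"
    have G: "eval_fps G has_fps_expansion G"
      using g by (intro eval_fps_has_fps_expansion) (auto simp: G_def has_fps_expansion_def)
    \<comment> \<open>Multiplying back by the power of the variable recovers \<open>F\<close>, and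
      two functions with the same expansion agree near 0.\<close>
    have "(\<lambda>y. y ^ k * eval_fps G y) has_fps_expansion fps_X ^ k * G"
      by (intro has_fps_expansion_mult G has_fps_expansion_fps_X_power)
    also have "fps_X ^ k * G = F"
      unfolding G_def k_def using subdegree_decompose[of F] by (simp add: mult.commute)
    finally have "\<forall>\<^sub>F y in nhds 0. eval_fps F y = y ^ k * eval_fps G y"
      by (simp add: has_fps_expansion_def)
    then have "\<forall>\<^sub>F y in nhds 0. a + y \<in> {0..1} \<longrightarrow>
        f (a + y) = ((a + y) - a) ^ k * eval_fps G ((a + y) - a)"
      using ev gF by eventually_elim auto
    then have "\<forall>\<^sub>F x in nhds a. x \<in> {0..1} \<longrightarrow> f x = (x - a) ^ k * eval_fps G (x - a)"
      by (subst (asm) eventually_nhds_shift_iff)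
    moreover have "eval_fps G 0 \<noteq> 0"
      using False by (simp add: eval_fps_at_0 G_def k_def)
    ultimately show thesis using order G by blast
  qed
qed

text \<open>In the finite order case the cofactor \<open>g\<close> is continuous and nonzero at 0,
  hence nonzero nearby, and \<open>(x - a) ^ k\<close> can vanish only at \<open>a\<close>.\<close>

lemma analytic_in_unit_at_isolated_zeros:
  assumes "analytic_in_unit_at f a"
  shows "(\<forall>\<^sub>F x in nhds a. x \<in> {0..1} \<longrightarrow> f x = 0) \<or>
    (\<forall>\<^sub>F x in nhds a. x \<in> {0..1} \<longrightarrow> x \<noteq> a \<longrightarrow> f x \<noteq> 0)"
  using assms
proof (cases rule: analytic_in_unit_at_local_form)
  case (order k g G)
  have "isCont g 0"
    using has_fps_expansion_imp_continuous[OF order(1), of UNIV] by simp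
  then have "\<forall>\<^sub>F y in nhds 0. g y \<noteq> 0"
    using continuous_at_avoid[of 0 g 0] order(2) by (simp add: eventually_nhds_metric dist_commute)
  then have "\<forall>\<^sub>F y in nhds 0. g ((a + y) - a) \<noteq> 0" by simp
  then have "\<forall>\<^sub>F x in nhds a. g (x - a) \<noteq> 0"
    by (subst (asm) eventually_nhds_shift_iff)
  with order(3) have "\<forall>\<^sub>F x in nhds a. x \<in> {0..1} \<longrightarrow> x \<noteq> a \<longrightarrow> f x \<noteq> 0"
    by eventually_elim auto
  then show ?thesis ..
qed simp

text \<open>This is the identity theorem. Having a nonzero germ is a locally constant property of
  the point, so by connectedness of \<open>[0,1]\<close> it spreads from \<open>x0\<close> to every
  \<open>b\<close>.\<close>

lemma real_analytic_on_unit_nonzero_germ: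
  assumes f: "real_analytic_on_unit f" and x0: "x0 \<in> {0..1}" "f x0 \<noteq> 0" and b: "b \<in> {0..1}"
  shows "\<not> (\<forall>\<^sub>F x in nhds b. x \<in> {0..1} \<longrightarrow> f x = 0)"
proof -
  let ?P = "\<lambda>a. \<not> (\<forall>\<^sub>F x in nhds a. x \<in> {0..1} \<longrightarrow> f x = 0)"
  have "?P x0" using x0 eventually_nhds_x_imp_x by fast
  show ?thesis
  proof (rule connected_induction_simple[of "{0..1}" x0 b ?P])
    fix a :: real
    assume a: "a \<in> {0..1}"
    then have "analytic_in_unit_at f a" using f by (simp add: real_analytic_on_unit_iff)
    then consider "\<forall>\<^sub>F x in nhds a. x \<in> {0..1} \<longrightarrow> f x = 0"
      | "\<forall>\<^sub>F x in nhds a. x \<in> {0..1} \<longrightarrow> x \<noteq> a \<longrightarrow> f x \<noteq> 0"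
      using analytic_in_unit_at_isolated_zeros by blast
    then show "\<exists>T. openin (top_of_set {0..1}) T \<and> a \<in> T \<and> (\<forall>x\<in>T. \<forall>y\<in>T. ?P x \<longrightarrow> ?P y)"
    proof cases
      case 1
      then obtain O' where O': "open O'" "a \<in> O'" "\<And>x. x \<in> O' \<Longrightarrow> x \<in> {0..1} \<Longrightarrow> f x = 0"
        unfolding eventually_nhds by blast
      \<comment> \<open>The open set \<open>O'\<close> is a neighbourhood of each of its points, so
        the germ of \<open>f\<close> is zero throughout it and the required implication is
        vacuous.\<close>
      then have "\<not> ?P x" if "x \<in> O'" for x
        using that unfolding eventually_nhds by blast
      then show ?thesis using O' a by (intro exI[of _ "{0..1} \<inter> O'"]) auto
    next
      case 2
      then obtain O' where O': "open O'" "a \<in> O'"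
        "\<And>x. x \<in> O' \<Longrightarrow> x \<in> {0..1} \<Longrightarrow> x \<noteq> a \<Longrightarrow> f x \<noteq> 0"
        unfolding eventually_nhds by blast
      \<comment> \<open>A zero germ at \<open>x\<close> would contradict isolation at points of
        \<open>[0,1]\<close> close to \<open>x\<close> but different from \<open>x\<close> and
        \<open>a\<close>. Working in the punctured filter at \<open>x\<close> treats
        \<open>x = a\<close> and \<open>x \<noteq> a\<close> together; the filter is nontrivial
        since \<open>x\<close> is a limit point of \<open>[0,1]\<close>.\<close>
      have "?P x" if x: "x \<in> {0..1} \<inter> O'" for x
      proof
        assume "\<forall>\<^sub>F y in nhds x. y \<in> {0..1} \<longrightarrow> f y = 0"
        then have "\<forall>\<^sub>F y in at x within {0..1}. y \<in> {0..1} \<longrightarrow> f y = 0"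
          by (auto simp: eventually_at_filter elim: eventually_mono)
        moreover have "\<forall>\<^sub>F y in at x within {0..1}. y \<in> {0..1}"
          by (simp add: eventually_at_filter)
        moreover have "\<forall>\<^sub>F y in at x within {0..1}. y \<noteq> a"
          by (rule eventually_neq_at_within)
        moreover have "\<forall>\<^sub>F y in at x within {0..1}. y \<in> O'"
          using x O'(1) by (auto simp: eventually_at_topological)
        ultimately have "\<forall>\<^sub>F y in at x within {0..1}. False"
          by eventually_elim (use O'(3) in auto)
        then show False
          using islimpt_Icc[of 0 1 x] x by (auto simp: trivial_limit_within)
      qed
      then show ?thesis using O' a by (intro exI[of _ "{0..1} \<inter> O'"]) auto
    qed
  qed (use x0 b \<open>?P x0\<close> in auto)
qed

text \<open>By compactness an infinite zero set would accumulate at some \<open>a\<close> in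
  \<open>[0,1]\<close>, where zeros are isolated because the germ is nonzero.\<close>

lemma real_analytic_on_unit_finite_zeros:
  assumes f: "real_analytic_on_unit f" and x0: "x0 \<in> {0..1}" "f x0 \<noteq> 0"
  shows "finite {x\<in>{0..1}. f x = 0}"
proof (rule ccontr)
  assume "infinite {x\<in>{0..1}. f x = 0}"
  moreover have "compact {0..1::real}" by simp
  ultimately obtain a where a: "a \<in> {0..1}" "a islimpt {x\<in>{0..1}. f x = 0}"
    using Heine_Borel_imp_Bolzano_Weierstrass[of "{0..1}" "{x\<in>{0..1}. f x = 0}"] by blast
  have "analytic_in_unit_at f a"
    using f a by (simp add: real_analytic_on_unit_iff)
  then have "\<forall>\<^sub>F x in nhds a. x \<in> {0..1} \<longrightarrow> x \<noteq> a \<longrightarrow> f x \<noteq> 0"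
    using analytic_in_unit_at_isolated_zeros real_analytic_on_unit_nonzero_germ[OF f x0 a(1)]
    by blast
  then show False
    using a(2) unfolding islimpt_def eventually_nhds by blast
qed

text \<open>Dividing out the full order of vanishing at \<open>a\<close> leaves a removable
  singularity, so the quotient stays analytic and no longer vanishes there.\<close>

lemma real_analytic_on_unit_split_zero:
  assumes f: "real_analytic_on_unit f" and x0: "x0 \<in> {0..1}" "f x0 \<noteq> 0" and a: "a \<in> {0..1}"
  obtains k h where "real_analytic_on_unit h" "h a \<noteq> 0"
    "\<And>x. x \<in> {0..1} \<Longrightarrow> f x = (x - a) ^ k * h x"
proof -
  have "analytic_in_unit_at f a"
    using f a by (simp add: real_analytic_on_unit_iff)
  then obtain k g G where g: "g has_fps_expansion G" "g 0 \<noteq> 0"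
    and ev: "\<forall>\<^sub>F x in nhds a. x \<in> {0..1} \<longrightarrow> f x = (x - a) ^ k * g (x - a)"
  proof (cases rule: analytic_in_unit_at_local_form)
    case zero
    then show ?thesis using real_analytic_on_unit_nonzero_germ[OF f x0 a] by blast
  next
    case (order k g G)
    then show ?thesis by (intro that)
  qed
  \<comment> \<open>The value \<open>g 0\<close> fills the singularity: near \<open>a\<close>,
    inside \<open>[0,1]\<close>, \<open>h\<close> then coincides with the shifted cofactor
    \<open>g (x - a)\<close>.\<close>
  define h where "h x = (if x = a then g 0 else f x / (x - a) ^ k)" for x
  have "analytic_in_unit_at h b" if b: "b \<in> {0..1}" for b
  proof (cases "b = a")
    case True
    have "\<forall>\<^sub>F x in nhds a. x \<in> {0..1} \<longrightarrow> h x = g (x - a)"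
      using ev by eventually_elim (auto simp: h_def)
    then have "\<forall>\<^sub>F y in nhds 0. a + y \<in> {0..1} \<longrightarrow> h (a + y) = g ((a + y) - a)"
      by (subst (asm) eventually_nhds_shift_iff[symmetric])
    then show ?thesis
      using g(1) True unfolding analytic_in_unit_at_def add_diff_cancel_left' by blast
  next
    case False
    \<comment> \<open>Away from \<open>a\<close> the divisor is a polynomial that is nonzero at
      \<open>b\<close>, so closure under products and inverses applies.\<close>
    have "analytic_in_unit_at (\<lambda>x. f x * inverse (poly ([:- a, 1:] ^ k) x)) b"
      using f b False
      by (intro analytic_in_unit_at_mult analytic_in_unit_at_inverse analytic_in_unit_at_poly)
         (auto simp: real_analytic_on_unit_iff)
    moreover have "\<forall>\<^sub>F x in nhds b. x \<noteq> a"
      using False by (intro t1_space_nhds)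
    then have "\<forall>\<^sub>F x in nhds b. x \<in> {0..1} \<longrightarrow> f x * inverse (poly ([:- a, 1:] ^ k) x) = h x"
      by eventually_elim (auto simp: h_def divide_inverse)
    ultimately show ?thesis by (rule analytic_in_unit_at_cong)
  qed
  then have "real_analytic_on_unit h" by (simp add: real_analytic_on_unit_iff)
  moreover have "f x = (x - a) ^ k * h x" if "x \<in> {0..1}" for x
    using eventually_nhds_x_imp_x[OF ev] that by (auto simp: h_def)
  moreover have "h a \<noteq> 0" using g(2) by (simp add: h_def)
  ultimately show thesis using that by blast
qed

section \<open>Factorization into a polynomial and a unit\<close>

text \<open>The conditions on \<open>u\<close> make it a unit of the ring, since its reciprocal is
  analytic. The polynomial is not unique: factors without zeros in \<open>[0,1]\<close> can be moved
  into \<open>u\<close>.\<close>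

definition poly_associate :: "(real \<Rightarrow> real) \<Rightarrow> real poly \<Rightarrow> (real \<Rightarrow> real) \<Rightarrow> bool" where
  "poly_associate f p u \<longleftrightarrow>
    real_analytic_on_unit u \<and> (\<forall>x\<in>{0..1}. u x \<noteq> 0 \<and> f x = poly p x * u x)"

text \<open>Induction on the number of zeros: splitting off one zero with its full order removes it
  from the zero set and creates no new one.\<close>

lemma real_analytic_on_unit_poly_associate:
  assumes "real_analytic_on_unit f" "x0 \<in> {0..1}" "f x0 \<noteq> 0"
  shows "\<exists>p u. poly_associate f p u"
  using assms
proof (induction "card {x\<in>{0..1}. f x = 0}" arbitrary: f rule: less_induct)
  case less
  have fin: "finite {x\<in>{0..1}. f x = 0}"
    by (rule real_analytic_on_unit_finite_zeros[OF less.prems])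
  show ?case
  proof (cases "\<exists>a\<in>{0..1}. f a = 0")
    case False
    \<comment> \<open>Without zeros \<open>f\<close> is itself the unit, with polynomial 1.\<close>
    then show ?thesis
      using less.prems by (intro exI[of _ 1] exI[of _ f]) (auto simp: poly_associate_def)
  next
    case True
    then obtain a where a: "a \<in> {0..1}" "f a = 0" by blast
    obtain k h where h: "real_analytic_on_unit h" "h a \<noteq> 0"
      and fh: "\<And>x. x \<in> {0..1} \<Longrightarrow> f x = (x - a) ^ k * h x"
      by (rule real_analytic_on_unit_split_zero[OF less.prems a(1)]) blast
    have "f x = 0" if "x \<in> {0..1}" "h x = 0" for x
      using fh[OF that(1)] that(2) by simp
    then have "{x\<in>{0..1}. h x = 0} \<subset> {x\<in>{0..1}. f x = 0}"
      using a h(2) by blast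
    then have "card {x\<in>{0..1}. h x = 0} < card {x\<in>{0..1}. f x = 0}"
      using fin by (intro psubset_card_mono)
    moreover have "h x0 \<noteq> 0" using fh[OF less.prems(2)] less.prems(3) by auto
    ultimately obtain p u where "poly_associate h p u"
      using less.hyps[OF _ h(1) less.prems(2)] by blast
    moreover have "poly ([:- a, 1:] ^ k * p) x = (x - a) ^ k * poly p x" for x
      by simp
    ultimately have "poly_associate f ([:- a, 1:] ^ k * p) u"
      unfolding poly_associate_def by (metis fh mult.assoc)
    then show ?thesis by blast
  qed
qed

section \<open>The ring structure and the absence of zero divisors\<close>

lemma Comega_ring_simps:
  "carrier Comega_ring = {f \<in> extensional {0..1}. real_analytic_on_unit f}"
  "mult Comega_ring f g = (\<lambda>x\<in>{0..1}. f x * g x)"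
  "add Comega_ring f g = (\<lambda>x\<in>{0..1}. f x + g x)"
  "one Comega_ring = (\<lambda>x\<in>{0..1}. 1)"
  "zero Comega_ring = (\<lambda>x\<in>{0..1}. 0)"
  by (simp_all add: Comega_ring_def)

lemma restrict_in_Comega_ring:
  "real_analytic_on_unit f \<Longrightarrow> restrict f {0..1} \<in> carrier Comega_ring"
  by (auto simp: Comega_ring_simps intro: real_analytic_on_unit_cong)

lemma Comega_ring_nonzeroE:
  assumes "f \<in> carrier Comega_ring - {\<zero>\<^bsub>Comega_ring\<^esub>}"
  obtains x where "x \<in> {0..1}" "f x \<noteq> 0"
proof -
  have "f \<in> extensional {0..1}" "f \<noteq> (\<lambda>x\<in>{0..1}. 0)"
    using assms by (simp_all add: Comega_ring_simps)
  then show thesis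
    using that extensionalityI[of f "{0..1}" "\<lambda>x\<in>{0..1}. 0"] by fastforce
qed

lemma cring_Comega_ring: "cring Comega_ring"
proof (rule cringI)
  show "abelian_group Comega_ring"
  proof (rule abelian_groupI)
    fix f assume f: "f \<in> carrier Comega_ring"
    let ?g = "\<lambda>x\<in>{0..1}. (- 1) * f x"
    have "?g \<in> carrier Comega_ring"
      using f by (intro restrict_in_Comega_ring real_analytic_on_unit_mult real_analytic_on_unit_const)
        (simp add: Comega_ring_simps)
    moreover have "?g \<oplus>\<^bsub>Comega_ring\<^esub> f = \<zero>\<^bsub>Comega_ring\<^esub>"
      by (auto simp: Comega_ring_simps)
    ultimately show "\<exists>g\<in>carrier Comega_ring. g \<oplus>\<^bsub>Comega_ring\<^esub> f = \<zero>\<^bsub>Comega_ring\<^esub>" by blast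
  next
    fix f g assume "f \<in> carrier Comega_ring" "g \<in> carrier Comega_ring"
    then show "f \<oplus>\<^bsub>Comega_ring\<^esub> g \<in> carrier Comega_ring"
      unfolding Comega_ring_simps(3)
      by (intro restrict_in_Comega_ring real_analytic_on_unit_add) (auto simp: Comega_ring_simps)
  next
    show "\<zero>\<^bsub>Comega_ring\<^esub> \<in> carrier Comega_ring"
      unfolding Comega_ring_simps(5)
      by (intro restrict_in_Comega_ring real_analytic_on_unit_const)
  qed (auto simp: Comega_ring_simps extensional_def fun_eq_iff restrict_def)
  show "comm_monoid Comega_ring"
  proof (rule comm_monoidI)
    fix f g assume "f \<in> carrier Comega_ring" "g \<in> carrier Comega_ring"
    then show "f \<otimes>\<^bsub>Comega_ring\<^esub> g \<in> carrier Comega_ring"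
      unfolding Comega_ring_simps(2)
      by (intro restrict_in_Comega_ring real_analytic_on_unit_mult) (auto simp: Comega_ring_simps)
  next
    show "\<one>\<^bsub>Comega_ring\<^esub> \<in> carrier Comega_ring"
      unfolding Comega_ring_simps(4)
      by (intro restrict_in_Comega_ring real_analytic_on_unit_const)
  qed (auto simp: Comega_ring_simps extensional_def fun_eq_iff restrict_def)
qed (auto simp: Comega_ring_simps fun_eq_iff restrict_def algebra_simps)

text \<open>Two nonzero functions have finitely many zeros altogether, but if their product were
  zero these zeros would fill the infinite set \<open>[0,1]\<close>.\<close>

lemma domain_Comega_ring: "domain Comega_ring"
proof (intro domain.intro cring_Comega_ring domain_axioms.intro)
  have "\<one>\<^bsub>Comega_ring\<^esub> 0 \<noteq> \<zero>\<^bsub>Comega_ring\<^esub> 0"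
    by (simp add: Comega_ring_simps)
  then show "\<one>\<^bsub>Comega_ring\<^esub> \<noteq> \<zero>\<^bsub>Comega_ring\<^esub>" by metis
next
  fix f g
  assume fg: "f \<otimes>\<^bsub>Comega_ring\<^esub> g = \<zero>\<^bsub>Comega_ring\<^esub>"
    and f: "f \<in> carrier Comega_ring" and g: "g \<in> carrier Comega_ring"
  show "f = \<zero>\<^bsub>Comega_ring\<^esub> \<or> g = \<zero>\<^bsub>Comega_ring\<^esub>"
  proof (rule ccontr)
    assume "\<not> ?thesis"
    then obtain x y where "x \<in> {0..1}" "f x \<noteq> 0" "y \<in> {0..1}" "g y \<noteq> 0"
      using f g by (metis Comega_ring_nonzeroE DiffI singletonD)
    then have "finite ({x\<in>{0..1}. f x = 0} \<union> {x\<in>{0..1}. g x = 0})"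
      using f g real_analytic_on_unit_finite_zeros by (auto simp: Comega_ring_simps)
    moreover have "f x * g x = 0" if "x \<in> {0..1}" for x
      using fun_cong[OF fg, of x] that by (simp add: Comega_ring_simps)
    then have "{x\<in>{0..1}. f x = 0} \<union> {x\<in>{0..1}. g x = 0} = {0..1}"
      by fastforce
    ultimately show False by (metis infinite_Icc zero_less_one)
  qed
qed

section \<open>Euclidean division and principal ideals\<close>

text \<open>For nonzero \<open>f\<close> this is the number of zeros in \<open>[0,1]\<close> counted
  with multiplicity. Taking a least degree avoids defining multiplicities, and any polynomial
  associate bounds the size from above.\<close>

definition Comega_size :: "(real \<Rightarrow> real) \<Rightarrow> nat" where
  "Comega_size f = (LEAST n. \<exists>p u. poly_associate f p u \<and> degree p = n)"

lemma Comega_size_le: "poly_associate f p u \<Longrightarrow> Comega_size f \<le> degree p"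
  unfolding Comega_size_def by (rule Least_le) blast

lemma Comega_size_attained:
  assumes "f \<in> carrier Comega_ring - {\<zero>\<^bsub>Comega_ring\<^esub>}"
  obtains p u where "poly_associate f p u" "degree p = Comega_size f"
proof -
  obtain x where "x \<in> {0..1}" "f x \<noteq> 0"
    using assms by (rule Comega_ring_nonzeroE)
  then have "\<exists>n p u. poly_associate f p u \<and> degree p = n"
    using assms real_analytic_on_unit_poly_associate[of f x] by (auto simp: Comega_ring_simps)
  from LeastI_ex[OF this] show thesis
    using that unfolding Comega_size_def by blast
qed

text \<open>Dividing a polynomial \<open>p\<close> associated to \<open>f\<close> by a polynomial
  \<open>q\<close> associated to \<open>g\<close> gives the division of \<open>f\<close> by
  \<open>g\<close>. Only \<open>q\<close> has to be of least degree: the remainder must be smaller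
  than \<open>Comega_size g\<close>.\<close>

lemma euclidean_domain_Comega_ring: "euclidean_domain Comega_ring Comega_size"
proof (rule domain.euclidean_domainI[OF domain_Comega_ring])
  fix f g
  assume f: "f \<in> carrier Comega_ring - {\<zero>\<^bsub>Comega_ring\<^esub>}"
    and g: "g \<in> carrier Comega_ring - {\<zero>\<^bsub>Comega_ring\<^esub>}"
  obtain p u where p: "poly_associate f p u"
    using f by (rule Comega_size_attained)
  obtain q v where q: "poly_associate g q v" "degree q = Comega_size g"
    using g by (rule Comega_size_attained)
  \<comment> \<open>Otherwise \<open>g\<close> would vanish on all of \<open>[0,1]\<close>.\<close>
  have "q \<noteq> 0"
    using q(1) by (auto intro: Comega_ring_nonzeroE[OF g] simp: poly_associate_def)
  \<comment> \<open>Multiply the polynomial division identity by \<open>u\<close>. As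
    \<open>g\<close> is \<open>q\<close> times \<open>v\<close>, the quotient needs the factor
    \<open>u / v\<close>, while the remainder keeps the unit \<open>u\<close>.\<close>
  define s where "s = (\<lambda>x\<in>{0..1}. poly (p div q) x * (u x * inverse (v x)))"
  define r where "r = (\<lambda>x\<in>{0..1}. poly (p mod q) x * u x)"
  have "s \<in> carrier Comega_ring" "r \<in> carrier Comega_ring"
    using p q(1) unfolding s_def r_def poly_associate_def
    by (auto intro!: restrict_in_Comega_ring real_analytic_on_unit_mult
        real_analytic_on_unit_inverse real_analytic_on_unit_poly)
  moreover have "f = g \<otimes>\<^bsub>Comega_ring\<^esub> s \<oplus>\<^bsub>Comega_ring\<^esub> r"
  proof
    fix x
    show "f x = (g \<otimes>\<^bsub>Comega_ring\<^esub> s \<oplus>\<^bsub>Comega_ring\<^esub> r) x"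
    proof (cases "x \<in> {0..1}")
      case True
      have "poly p x = poly (q * (p div q) + p mod q) x"
        by simp
      then have "poly p x = poly q x * poly (p div q) x + poly (p mod q) x"
        by (simp only: poly_add poly_mult)
      then show ?thesis
        using True p q(1)
        by (simp add: Comega_ring_simps poly_associate_def s_def r_def field_simps)
    next
      case False
      then show ?thesis using f by (auto simp: Comega_ring_simps extensional_def)
    qed
  qed
  moreover have "r = \<zero>\<^bsub>Comega_ring\<^esub> \<or> Comega_size r < Comega_size g"
  proof (cases "p mod q = 0")
    case True
    then show ?thesis by (auto simp: r_def Comega_ring_simps)
  next
    case False
    \<comment> \<open>The remainder is associated to \<open>p mod q\<close> through the same unit
      \<open>u\<close>, so its size is at most that degree, which is below
      \<open>degree q\<close>.\<close>
    have "poly_associate r (p mod q) u"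
      using p by (auto simp: poly_associate_def r_def)
    then have "Comega_size r \<le> degree (p mod q)"
      by (rule Comega_size_le)
    also have "\<dots> < Comega_size g"
      using degree_mod_less'[OF \<open>q \<noteq> 0\<close> False] q(2) by simp
    finally show ?thesis ..
  qed
  ultimately show "\<exists>s r. s \<in> carrier Comega_ring \<and> r \<in> carrier Comega_ring \<and>
      f = g \<otimes>\<^bsub>Comega_ring\<^esub> s \<oplus>\<^bsub>Comega_ring\<^esub> r \<and>
      (r = \<zero>\<^bsub>Comega_ring\<^esub> \<or> Comega_size r < Comega_size g)"
    by blast
qed

theorem mainTheorem3:
  shows "principal_domain Comega_ring"
proof -
  \<comment> \<open>Every Euclidean domain is a principal ideal domain, so the interpretation
    already supplies the claim.\<close>
  interpret euclidean_domain Comega_ring Comega_size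
    by (rule euclidean_domain_Comega_ring)
  show ?thesis by (rule principal_domain_axioms)
qed

end
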